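(* The map $\mathcal{B}$ is a bijection from the set of positive Dyck numbers onto the set of symmetric Dyck numbers. Moreover, for every $n\ge 1$, $\mathcal{B}$ sends each positive Dyck number of binary length $n$ to a Dyck number that encodes a symmetric Dyck path of semilength $n-1$.
   Context: A nonnegative integer $d$ is a Dyck number if, in its binary expansion (written without leading zeros, the expansion of $0$ being the empty word), every suffix contains at least as many digits 1 as digits 0. A Dyck number $d$ with $w$ ones and $z\le w$ zeros in its binary expansion encodes the Dyck word (Dyck path) of length $2w$ (semilength $w$) obtained by prepending $w-z$ zeros to the binary expansion, where $0$ stands for an up-step (left parenthesis) and $1$ for a down-step (right parenthesis); $0$ encodes the empty Dyck word. A Dyck word $d_1d_2\cdots d_{2w}$ is symmetric if $d_i\ne d_{2w+1-i}$ for all $1\le i\le 2w$ (i.e. the Dyck path is symmetric under reflection in a vertical line). A Dyck number is symmetric if the Dyck word it encodes is symmetric (in particular $0$ is symmetric), and asymmetric otherwise. The map $\mathcal{B}$ is defined on positive Dyck numbers $d$ as follows: write the binary expansion of $d$ as $1s$ with $s$ a binary word (possibly empty, possibly beginning with zeros); let $\bar s$ be the word of the same length obtained by reversing $s$ and swapping $0\leftrightarrow 1$ in every position; then $\mathcal{B}(d)$ is the integer whose binary representation (after removing leading zeros) is the concatenation $\bar s s$. For example $\mathcal{B}(1)=0$, and $\mathcal{B}(19)=51$ since $19=10011_2$, $s=0011$, $\bar s=0011$, $\bar s s=00110011$. *)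

theory Defs
  imports Main "HOL-Library.Sublist"
begin

text \<open>Binary words are lists of booleans, most significant digit first:
  \<open>True\<close> is the digit 1 (a down-step), \<open>False\<close> is the digit 0 (an up-step).\<close>

fun binary_expansion :: "nat \<Rightarrow> bool list" where
  "binary_expansion n =
     (if n = 0 then [] else binary_expansion (n div 2) @ [odd n])"

declare binary_expansion.simps [simp del]

text \<open>The library's \<open>horner_sum\<close> reads the least significant digit first.\<close>

definition binary_value :: "bool list \<Rightarrow> nat" where
  "binary_value xs = horner_sum of_bool 2 (rev xs)"

definition ones :: "bool list \<Rightarrow> nat" where
  "ones xs = count_list xs True"

definition zeros :: "bool list \<Rightarrow> nat" where
  "zeros xs = count_list xs False"

definition dyck_word :: "bool list \<Rightarrow> bool" where
  "dyck_word p \<longleftrightarrow> zeros p = ones p \<and> (\<forall>u. prefix u p \<longrightarrow> ones u \<le> zeros u)"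

definition semilength :: "bool list \<Rightarrow> nat" where
  "semilength p = length p div 2"

text \<open>Positions are counted from 0, so position \<open>i\<close> is matched with
  \<open>length p - 1 - i\<close>.\<close>

definition symmetric_word :: "bool list \<Rightarrow> bool" where
  "symmetric_word p \<longleftrightarrow> (\<forall>i < length p. p ! i \<noteq> p ! (length p - 1 - i))"

definition dyck_number :: "nat \<Rightarrow> bool" where
  "dyck_number d \<longleftrightarrow> (\<forall>u. suffix u (binary_expansion d) \<longrightarrow> zeros u \<le> ones u)"

text \<open>The subtraction does not truncate when \<open>d\<close> is a Dyck number.\<close>

definition encoded_word :: "nat \<Rightarrow> bool list" where
  "encoded_word d =
     replicate (ones (binary_expansion d) - zeros (binary_expansion d)) False
       @ binary_expansion d"

definition symmetric_dyck_number :: "nat \<Rightarrow> bool" where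
  "symmetric_dyck_number d \<longleftrightarrow> dyck_number d \<and> symmetric_word (encoded_word d)"

text \<open>Meaningful only for \<open>d > 0\<close>, where \<open>tl\<close> removes the leading digit 1.\<close>

definition B_map :: "nat \<Rightarrow> nat" where
  "B_map d = (let s = tl (binary_expansion d) in binary_value (map Not (rev s) @ s))"

lemma B_map_1: "B_map 1 = 0"
  by code_simp

lemma B_map_19: "B_map 19 = 51"
  by code_simp

end

(* The word s-bar s is balanced and symmetric, and its suffix condition is equivalent to that of s,
   hence to that of 1s. A balanced word is recovered from its numerical value by the encoding, because
   the number of leading zeros lost is exactly the excess of ones over zeros; so B(1s) encodes the
   word s-bar s, which determines s as its second half. *)

theory Submission
  imports Defs
begin

section \<open>Reversal with complementation, and digit counts\<close>

definition mirror :: "bool list \<Rightarrow> bool list" where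
  "mirror xs = map Not (rev xs)"

text \<open>Stated for arbitrary words, leading zeros included, so that it applies both to binary
  expansions and to their padded Dyck words.\<close>

definition suffix_dominated :: "bool list \<Rightarrow> bool" where
  "suffix_dominated xs \<longleftrightarrow> (\<forall>u. suffix u xs \<longrightarrow> zeros u \<le> ones u)"

lemma ones_simps [simp]:
  "ones [] = 0" "ones (x # xs) = of_bool x + ones xs" "ones (xs @ ys) = ones xs + ones ys"
  by (auto simp: ones_def)

lemma zeros_simps [simp]:
  "zeros [] = 0" "zeros (x # xs) = of_bool (\<not> x) + zeros xs"
  "zeros (xs @ ys) = zeros xs + zeros ys"
  by (auto simp: zeros_def)

lemma ones_zeros_replicate_False [simp]:
  "ones (replicate k False) = 0" "zeros (replicate k False) = k"
  by (induction k) auto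

lemma length_eq_ones_plus_zeros: "length xs = ones xs + zeros xs"
  by (induction xs) auto

lemma length_mirror [simp]: "length (mirror xs) = length xs"
  by (simp add: mirror_def)

lemma mirror_append: "mirror (xs @ ys) = mirror ys @ mirror xs"
  by (simp add: mirror_def)

lemma mirror_mirror [simp]: "mirror (mirror xs) = xs"
  by (simp add: mirror_def rev_map comp_def)

lemma ones_mirror [simp]: "ones (mirror xs) = zeros xs"
  by (induction xs) (auto simp: mirror_def)

lemma zeros_mirror [simp]: "zeros (mirror xs) = ones xs"
  by (induction xs) (auto simp: mirror_def)

text \<open>Two digits differ iff one is the negation of the other, so the positionwise condition
  becomes a fixed-point equation that \<open>mirror_append\<close> can handle.\<close>

lemma symmetric_word_iff_mirror: "symmetric_word p \<longleftrightarrow> mirror p = p"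
proof -
  have "mirror p ! i \<longleftrightarrow> \<not> p ! (length p - 1 - i)" if "i < length p" for i
    using that by (simp add: mirror_def rev_nth)
  then show ?thesis
    unfolding symmetric_word_def list_eq_iff_nth_eq length_mirror by blast
qed

text \<open>Cutting both \<open>p\<close> and \<open>mirror p\<close> after \<open>m\<close> digits
  gives blocks of equal lengths, so the first blocks agree.\<close>

lemma symmetric_word_halves:
  assumes "symmetric_word p" "length p = 2 * m"
  shows "mirror (drop m p) @ drop m p = p"
proof -
  have "take m p @ drop m p = mirror (drop m p) @ mirror (take m p)"
    using assms(1) unfolding symmetric_word_iff_mirror
    by (metis append_take_drop_id mirror_append)
  then have "take m p = mirror (drop m p)"
    by (rule append_eq_append_conv[THEN iffD1, THEN conjunct1, rotated]) (simp add: assms(2))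
  then show ?thesis
    by (metis append_take_drop_id)
qed

section \<open>Binary expansions and values\<close>

lemma binary_expansion_0 [simp]: "binary_expansion 0 = []"
  by (simp add: binary_expansion.simps)

lemma binary_value_Nil [simp]: "binary_value [] = 0"
  by (simp add: binary_value_def)

lemma binary_value_snoc [simp]: "binary_value (xs @ [b]) = 2 * binary_value xs + of_bool b"
  by (simp add: binary_value_def)

lemma binary_value_expansion: "binary_value (binary_expansion n) = n"
proof (induction n rule: less_induct)
  case (less n)
  show ?case
  proof (cases "n = 0")
    case True
    then show ?thesis by simp
  next
    case False
    then have "binary_value (binary_expansion n) = 2 * (n div 2) + of_bool (odd n)"
      using less by (subst binary_expansion.simps) simp
    then show ?thesis by (auto elim!: oddE)
  qed
qed

lemma binary_value_eq_0_iff: "binary_value xs = 0 \<longleftrightarrow> (\<forall>x\<in>set xs. \<not> x)"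
  by (induction xs rule: rev_induct) auto

lemma binary_expansion_value: "binary_expansion (binary_value xs) = dropWhile Not xs"
proof (induction xs rule: rev_induct)
  case Nil
  show ?case by simp
next
  case (snoc b xs)
  show ?case
  proof (cases "binary_value (xs @ [b]) = 0")
    case True
    moreover from this have "dropWhile Not (xs @ [b]) = []"
      by (simp only: binary_value_eq_0_iff dropWhile_eq_Nil_conv)
    ultimately show ?thesis by (simp only: binary_expansion_0)
  next
    case False
    \<comment> \<open>The last digit survives the removal of leading zeros: either \<open>xs\<close>
      already contains a 1, or \<open>xs\<close> is all zeros and \<open>b\<close> itself must be
      the 1.\<close>
    have "dropWhile Not (xs @ [b]) = dropWhile Not xs @ [b]"
    proof (cases "binary_value xs = 0")
      case True
      with False have b by (cases b) auto
      with True show ?thesis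
        by (auto simp: binary_value_eq_0_iff dropWhile_append)
    next
      case False
      then show ?thesis
        by (auto simp: binary_value_eq_0_iff)
    qed
    moreover have "binary_value (xs @ [b]) div 2 = binary_value xs"
      "odd (binary_value (xs @ [b])) = b"
      by (cases b; simp)+
    ultimately show ?thesis
      using False snoc by (subst binary_expansion.simps) simp
  qed
qed

lemma binary_value_replicate_False_append:
  "binary_value (replicate k False @ xs) = binary_value xs"
proof (induction xs rule: rev_induct)
  case Nil
  show ?case by (simp add: binary_value_eq_0_iff)
next
  case (snoc b xs)
  then show ?case
    using binary_value_snoc[of "replicate k False @ xs" b] by simp
qed

lemma binary_expansion_pos:
  assumes "d > 0"
  shows "binary_expansion d = True # tl (binary_expansion d)"
proof -
  have "dropWhile Not (binary_expansion d) = binary_expansion d"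
    using binary_expansion_value[of "binary_expansion d"] by (simp add: binary_value_expansion)
  moreover have "binary_expansion d \<noteq> []"
    using assms binary_value_expansion[of d] by auto
  ultimately show ?thesis
    by (metis dropWhile_eq_self_iff list.collapse)
qed

section \<open>The suffix condition and Dyck words\<close>

lemma dyck_number_iff: "dyck_number d \<longleftrightarrow> suffix_dominated (binary_expansion d)"
  by (simp add: dyck_number_def suffix_dominated_def)

lemma suffix_dominated_suffix:
  "suffix_dominated ys \<Longrightarrow> suffix xs ys \<Longrightarrow> suffix_dominated xs"
  unfolding suffix_dominated_def using suffix_order.trans by blast

text \<open>The only new suffix is the whole word, which has one more 1 than the suffix
  \<open>s\<close>.\<close>

lemma suffix_dominated_True_Cons:
  "suffix_dominated (True # s) \<longleftrightarrow> suffix_dominated s"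
  unfolding suffix_dominated_def suffix_Cons by (auto intro: le_SucI)

lemma suffix_dominated_mirror_append:
  assumes "suffix_dominated s"
  shows "suffix_dominated (mirror s @ s)"
  unfolding suffix_dominated_def
proof (intro allI impI)
  fix u assume "suffix u (mirror s @ s)"
  then consider "suffix u s" | v w where "u = v @ s" "mirror s = w @ v"
    unfolding suffix_append by (metis suffix_def)
  then show "zeros u \<le> ones u"
  proof cases
    case 1
    with assms show ?thesis by (simp add: suffix_dominated_def)
  next
    \<comment> \<open>In \<open>u = v @ mirror v @ mirror w\<close> the part
      \<open>v @ mirror v\<close> is balanced, which leaves \<open>mirror w\<close>, a suffix of
      \<open>s\<close>.\<close>
    case 2
    then have s: "s = mirror v @ mirror w"
      by (metis mirror_append mirror_mirror)
    then have "zeros (mirror w) \<le> ones (mirror w)"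
      using assms by (auto simp: suffix_dominated_def suffix_def)
    then show ?thesis using 2(1) s by simp
  qed
qed

text \<open>In a balanced word the excess of zeros in a prefix equals the excess of ones in the
  complementary suffix.\<close>

lemma dyck_word_balanced:
  assumes "zeros p = ones p" "suffix_dominated p"
  shows "dyck_word p"
  unfolding dyck_word_def
proof (intro conjI allI impI)
  fix u assume "prefix u p"
  then obtain v where v: "p = u @ v" by (auto simp: prefix_def)
  then have "zeros v \<le> ones v"
    using assms(2) by (auto simp: suffix_dominated_def suffix_def)
  then show "ones u \<le> zeros u" using assms(1) v by simp
qed (fact assms(1))

lemma encoded_word_value:
  assumes "zeros p = ones p"
  shows "encoded_word (binary_value p) = p"
proof -
  define q where "q = dropWhile Not p"
  define k where "k = length (takeWhile Not p)"
  have "takeWhile Not p = replicate k False"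
    unfolding k_def by (rule replicate_length_same[symmetric]) (auto dest: set_takeWhileD)
  then have p: "p = replicate k False @ q"
    unfolding q_def by (metis takeWhile_dropWhile_id)
  \<comment> \<open>Balance of \<open>p\<close> reads \<open>k + zeros q = ones q\<close>.\<close>
  then have "ones q - zeros q = k" using assms by simp
  then show ?thesis
    unfolding encoded_word_def binary_expansion_value q_def[symmetric] using p by simp
qed

text \<open>The whole expansion is a suffix of itself, so the subtraction giving the padding is
  exact.\<close>

lemma encoded_word_balanced:
  assumes "dyck_number d"
  shows "zeros (encoded_word d) = ones (encoded_word d)"
  using assms by (auto simp: encoded_word_def dyck_number_def)

lemma binary_value_encoded_word: "binary_value (encoded_word d) = d"
  by (simp add: encoded_word_def binary_value_replicate_False_append binary_value_expansion)

section \<open>The map \<open>B_map\<close> and its inverse\<close>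

lemma B_map_eq:
  "B_map d = binary_value (mirror (tl (binary_expansion d)) @ tl (binary_expansion d))"
  by (simp add: B_map_def mirror_def Let_def)

lemma encoded_word_B_map:
  "encoded_word (B_map d) = mirror (tl (binary_expansion d)) @ tl (binary_expansion d)"
  by (simp add: B_map_eq encoded_word_value)

lemma symmetric_word_B_map: "symmetric_word (encoded_word (B_map d))"
  by (simp add: encoded_word_B_map symmetric_word_iff_mirror mirror_append)

text \<open>Covers the padded word, hence serves both for its Dyck property and, by restriction to a
  suffix, for the number \<open>B_map d\<close>.\<close>

lemma suffix_dominated_B_map:
  assumes "d > 0" "dyck_number d"
  shows "suffix_dominated (encoded_word (B_map d))"
  using assms binary_expansion_pos[of d]
  by (metis dyck_number_iff encoded_word_B_map suffix_dominated_True_Cons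
      suffix_dominated_mirror_append)

lemma dyck_number_B_map:
  assumes "d > 0" "dyck_number d"
  shows "dyck_number (B_map d)"
  using suffix_dominated_suffix[OF suffix_dominated_B_map[OF assms]]
  by (simp add: dyck_number_iff encoded_word_def suffix_def)

lemma inj_on_B_map: "inj_on B_map {d. d > 0}"
proof (rule inj_onI)
  fix d e assume de: "d \<in> {d. d > 0}" "e \<in> {d. d > 0}" "B_map d = B_map e"
  let ?s = "tl (binary_expansion d)" and ?t = "tl (binary_expansion e)"
  have eq: "mirror ?s @ ?s = mirror ?t @ ?t"
    using de(3) by (metis encoded_word_B_map)
  \<comment> \<open>Each side is twice as long as its second half, so the halves can be
    compared.\<close>
  then have "length ?s = length ?t"
    by (auto dest!: arg_cong[where f = length])
  with eq have "?s = ?t" by simp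
  \<comment> \<open>Positivity restores the leading 1 dropped by \<open>tl\<close>.\<close>
  then have "binary_expansion d = binary_expansion e"
    using de binary_expansion_pos by (metis mem_Collect_eq)
  then show "d = e" by (metis binary_value_expansion)
qed

text \<open>The preimage is read off by putting a 1 in front of the second half of the encoded
  word.\<close>

lemma symmetric_dyck_number_in_B_map_image:
  assumes "symmetric_dyck_number e"
  obtains d where "d > 0" "dyck_number d" "B_map d = e"
proof -
  define p where "p = encoded_word e"
  \<comment> \<open>Padding adds no ones, so by balance \<open>m\<close> is half the length of
    \<open>p\<close>.\<close>
  define m where "m = ones (binary_expansion e)"
  define s where "s = drop m p"
  have e: "dyck_number e" "symmetric_word p"
    using assms by (auto simp: symmetric_dyck_number_def p_def)
  have len: "length p = 2 * m"
    using encoded_word_balanced[OF e(1)]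
    by (simp add: length_eq_ones_plus_zeros p_def m_def encoded_word_def)
  \<comment> \<open>The expansion contains \<open>m\<close> ones, so it has at least
    \<open>m\<close> digits and the second half of \<open>p\<close> does not reach into the
    padding.\<close>
  have "suffix s (binary_expansion e)"
  proof (rule suffix_length_suffix)
    show "suffix s p" by (simp add: s_def suffix_drop)
    show "suffix (binary_expansion e) p" by (simp add: p_def encoded_word_def suffix_def)
    show "length s \<le> length (binary_expansion e)"
      using len by (simp add: s_def m_def length_eq_ones_plus_zeros[of "binary_expansion e"])
  qed
  then have s: "suffix_dominated s"
    using e(1) suffix_dominated_suffix by (auto simp: dyck_number_iff)
  define d where "d = binary_value (True # s)"
  have exp: "binary_expansion d = True # s"
    by (simp add: d_def binary_expansion_value)
  show thesis
  proof
    show "d > 0" by (simp add: d_def binary_value_eq_0_iff flip: neq0_conv)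
    show "dyck_number d" using s by (simp add: dyck_number_iff exp suffix_dominated_True_Cons)
    have "B_map d = binary_value p"
      using symmetric_word_halves[OF e(2) len] by (simp add: B_map_eq exp s_def)
    then show "B_map d = e" by (simp add: p_def binary_value_encoded_word)
  qed
qed

theorem mainTheorem2:
  shows "bij_betw B_map {d. d > 0 \<and> dyck_number d} {d. symmetric_dyck_number d} \<and>
    (\<forall>n\<ge>1. \<forall>d. d > 0 \<and> dyck_number d \<and> length (binary_expansion d) = n \<longrightarrow>
       dyck_number (B_map d) \<and>
       dyck_word (encoded_word (B_map d)) \<and>
       symmetric_word (encoded_word (B_map d)) \<and>
       semilength (encoded_word (B_map d)) = n - 1)"
proof (intro conjI allI impI)
  have "inj_on B_map {d. d > 0 \<and> dyck_number d}"
    by (rule inj_on_subset[OF inj_on_B_map]) auto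
  moreover have "B_map ` {d. d > 0 \<and> dyck_number d} = {d. symmetric_dyck_number d}"
  proof (intro equalityI subsetI)
    fix e assume "e \<in> B_map ` {d. d > 0 \<and> dyck_number d}"
    then show "e \<in> {d. symmetric_dyck_number d}"
      using dyck_number_B_map symmetric_word_B_map by (auto simp: symmetric_dyck_number_def)
  next
    fix e assume "e \<in> {d. symmetric_dyck_number d}"
    then obtain d where "d > 0" "dyck_number d" "B_map d = e"
      using symmetric_dyck_number_in_B_map_image by blast
    then show "e \<in> B_map ` {d. d > 0 \<and> dyck_number d}" by blast
  qed
  ultimately show "bij_betw B_map {d. d > 0 \<and> dyck_number d} {d. symmetric_dyck_number d}"
    by (simp add: bij_betw_def)
next
  fix n d :: nat
  assume "d > 0 \<and> dyck_number d \<and> length (binary_expansion d) = n"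
  then have d: "d > 0" "dyck_number d" "length (binary_expansion d) = n" by auto
  show "dyck_number (B_map d)" using d(1,2) by (rule dyck_number_B_map)
  show "dyck_word (encoded_word (B_map d))"
    using encoded_word_balanced[OF dyck_number_B_map[OF d(1,2)]] suffix_dominated_B_map[OF d(1,2)]
    by (rule dyck_word_balanced)
  show "symmetric_word (encoded_word (B_map d))" by (rule symmetric_word_B_map)
  \<comment> \<open>Dropping the leading digit leaves \<open>n - 1\<close> digits; mirroring doubles
    this and \<open>semilength\<close> halves it.\<close>
  show "semilength (encoded_word (B_map d)) = n - 1"
    using d(3) by (simp add: semilength_def encoded_word_B_map)
qed

end
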